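(* Let $r\ge 3$ and $n\ge 1$ be integers. Then $$ex_r^{\mathrm{lin}}(n,B_4^r)\le \frac{(r+1)n}{r}.$$ Moreover, if a Steiner system $S(2,r,r^2)$ exists, then a linear $r$-uniform hypergraph $H$ on $n$ vertices is $B_4^r$-free with $|E(H)|=\frac{(r+1)n}{r}$ if and only if $H$ is a vertex-disjoint union of Steiner systems $S(2,r,r^2)$.
   Context: All hypergraphs are finite. A hypergraph is $r$-uniform if each hyperedge has exactly $r$ vertices, and linear if any two distinct hyperedges intersect in at most one vertex. A hypergraph $H$ contains $F$ as a subhypergraph if there is an injective map $V(F)\to V(H)$ sending every hyperedge of $F$ to a hyperedge of $H$; otherwise $H$ is $F$-free. The linear Turán number $ex_r^{\mathrm{lin}}(n,F)$ is the maximum number of hyperedges in an $F$-free linear $r$-uniform hypergraph on $n$ vertices. The expansion $G^r$ of a graph $G$ is the $r$-uniform hypergraph obtained by enlarging each edge of $G$ with $r-2$ new vertices, the new vertices for different edges being distinct. $B_4$ is the tree with four edges obtained from the star $S_3$ with three edges by attaching an extra edge at a leaf, and $B_4^r$ is its expansion; explicitly, $B_4^r$ consists of four hyperedges $e_1,e_2,e_3,e_4$ of size $r$ where $e_1,e_2,e_3$ share exactly one common vertex $v$ and are otherwise pairwise disjoint, $e_4$ meets $e_3$ in exactly one vertex different from $v$, and $e_4$ is disjoint from $e_1\cup e_2$. A Steiner system $S(2,r,m)$ is a set of $m$ vertices together with a family of $r$-element subsets (blocks, viewed as hyperedges) such that every pair of distinct vertices lies in exactly one block. *)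

theory Defs
  imports Complex_Main
begin

datatype 'a hypergraph = Hypergraph (verts: "'a set") (edges: "'a set set")

definition hypergraph :: "'a hypergraph \<Rightarrow> bool" where
  "hypergraph H \<longleftrightarrow> finite (verts H) \<and> (\<forall>e\<in>edges H. e \<subseteq> verts H)"

definition uniform :: "nat \<Rightarrow> 'a hypergraph \<Rightarrow> bool" where
  "uniform r H \<longleftrightarrow> (\<forall>e\<in>edges H. card e = r)"

definition linear_hypergraph :: "'a hypergraph \<Rightarrow> bool" where
  "linear_hypergraph H \<longleftrightarrow>
    (\<forall>e\<in>edges H. \<forall>f\<in>edges H. e \<noteq> f \<longrightarrow> card (e \<inter> f) \<le> 1)"

definition contains_hypergraph :: "'a hypergraph \<Rightarrow> 'b hypergraph \<Rightarrow> bool" where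
  "contains_hypergraph H F \<longleftrightarrow>
    (\<exists>\<phi>. inj_on \<phi> (verts F) \<and> \<phi> ` verts F \<subseteq> verts H \<and> (\<forall>e\<in>edges F. \<phi> ` e \<in> edges H))"

definition hypergraph_free :: "'a hypergraph \<Rightarrow> 'b hypergraph \<Rightarrow> bool" where
  "hypergraph_free H F \<longleftrightarrow> \<not> contains_hypergraph H F"

text \<open>
  Every finite hypergraph is isomorphic to one whose vertices are natural numbers, so it is enough
  to range over those. The set below is bounded by \<open>2 ^ n\<close>, and it is nonempty (it contains 0)
  as soon as \<open>F\<close> has a hyperedge, so \<open>Max\<close> is then a genuine maximum.
\<close>

definition lin_turan :: "nat \<Rightarrow> nat \<Rightarrow> 'b hypergraph \<Rightarrow> nat" where
  "lin_turan r n F = Max {card (edges H) | H :: nat hypergraph.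
     hypergraph H \<and> uniform r H \<and> linear_hypergraph H \<and> card (verts H) = n \<and> hypergraph_free H F}"

text \<open>
  A graph is a 2-uniform hypergraph. In its expansion the old vertices are tagged \<open>Inl\<close>, and
  the new vertices of the edge \<open>e\<close> are \<open>Inr (e, i)\<close> for \<open>i < r - 2\<close> (used only for \<open>r \<ge> 2\<close>).
\<close>

definition expansion :: "nat \<Rightarrow> 'a hypergraph \<Rightarrow> ('a + 'a set \<times> nat) hypergraph" where
  "expansion r G = Hypergraph
     (Inl ` verts G \<union> Inr ` (edges G \<times> {..<r - 2}))
     ((\<lambda>e. Inl ` e \<union> Inr ` ({e} \<times> {..<r - 2})) ` edges G)"

text \<open>The star with centre 0 and leaves 1, 2, 3, with an extra edge attached at the leaf 3.\<close>

definition B4 :: "nat hypergraph" where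
  "B4 = Hypergraph {0, 1, 2, 3, 4} {{0, 1}, {0, 2}, {0, 3}, {3, 4}}"

text \<open>\<open>steiner_system r m S\<close> says that \<open>S\<close> is a Steiner system S(2, r, m).\<close>

definition steiner_system :: "nat \<Rightarrow> nat \<Rightarrow> 'a hypergraph \<Rightarrow> bool" where
  "steiner_system r m S \<longleftrightarrow> hypergraph S \<and> card (verts S) = m \<and> uniform r S \<and>
    (\<forall>x\<in>verts S. \<forall>y\<in>verts S. x \<noteq> y \<longrightarrow> (\<exists>!b. b \<in> edges S \<and> x \<in> b \<and> y \<in> b))"

definition disjoint_union_of :: "('a hypergraph \<Rightarrow> bool) \<Rightarrow> 'a hypergraph \<Rightarrow> bool" where
  "disjoint_union_of P H \<longleftrightarrow>
    (\<exists>\<C>. (\<forall>S\<in>\<C>. P S) \<and> pairwise (\<lambda>S T. disjnt (verts S) (verts T)) \<C> \<and>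
      verts H = (\<Union>S\<in>\<C>. verts S) \<and> edges H = (\<Union>S\<in>\<C>. edges S))"

end

theory Submission
  imports Defs
begin

text \<open>
  Count incidences: \<open>r |E| = (\<Sum>v. deg v)\<close>. If an edge \<open>f\<close> avoids \<open>v\<close> but meets an edge through \<open>v\<close>,
  then freeness leaves at most one edge through \<open>v\<close> disjoint from \<open>f\<close>, so
  \<open>deg v \<le> 1 + |f \<inter> star v| \<le> r + 1\<close>, where \<open>star v\<close> is the closed neighbourhood of \<open>v\<close>.
  A vertex of degree at least \<open>r + 2\<close> is therefore the centre of a component all of whose other
  vertices have degree 1, and such components are sparse. In the case of equality all degrees are
  \<open>r + 1\<close>, every star has \<open>r\<^sup>2\<close> vertices, and the inequality forces each edge meeting a star to
  lie inside it. So the stars partition the vertex set and each of them is a Steiner system.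
  Conversely, in an affine plane two lines through \<open>v\<close> cannot both be disjoint from a third line.
\<close>

section \<open>Degrees and stars\<close>

definition edges_at :: "'a hypergraph \<Rightarrow> 'a \<Rightarrow> 'a set set" where
  "edges_at H v = {e \<in> edges H. v \<in> e}"

definition star :: "'a hypergraph \<Rightarrow> 'a \<Rightarrow> 'a set" where
  "star H v = insert v (\<Union>(edges_at H v))"

lemma hypergraph_finite_edges: "hypergraph H \<Longrightarrow> finite (edges H)"
  unfolding hypergraph_def by (rule finite_subset[of _ "Pow (verts H)"]) auto

lemma hypergraph_finite_edge: "hypergraph H \<Longrightarrow> e \<in> edges H \<Longrightarrow> finite e"
  unfolding hypergraph_def by (meson finite_subset)

lemma hypergraph_finite_edges_at: "hypergraph H \<Longrightarrow> finite (edges_at H v)"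
  unfolding edges_at_def by (simp add: hypergraph_finite_edges)

lemma star_subset_verts: "hypergraph H \<Longrightarrow> v \<in> verts H \<Longrightarrow> star H v \<subseteq> verts H"
  unfolding star_def edges_at_def hypergraph_def by auto

text \<open>Working form of linearity. \<open>hypergraph H\<close> supplies finiteness of
  \<open>e \<inter> f\<close>; an infinite intersection would have cardinality 0 by
  convention.\<close>

lemma linear_hypergraph_eq:
  assumes "hypergraph H" "linear_hypergraph H" "e \<in> edges H" "f \<in> edges H"
    and "x \<in> e" "x \<in> f" "y \<in> e" "y \<in> f" "x \<noteq> y"
  shows "e = f"
proof (rule ccontr)
  assume "e \<noteq> f"
  then have "card (e \<inter> f) \<le> 1"
    using assms unfolding linear_hypergraph_def by auto
  moreover have "card {x, y} \<le> card (e \<inter> f)"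
    using assms hypergraph_finite_edge by (intro card_mono) auto
  ultimately show False using assms by auto
qed

text \<open>Double counting of incidences. It is stated for a subfamily \<open>F\<close> because the
  upper bound applies it after the edges through vertices of large degree have been removed.\<close>

lemma sum_degrees:
  assumes "hypergraph H" "uniform r H" "F \<subseteq> edges H" "\<Union>F \<subseteq> V" "finite V"
  shows "(\<Sum>v\<in>V. card {e \<in> F. v \<in> e}) = r * card F"
proof -
  have fF: "finite F" using assms hypergraph_finite_edges finite_subset by blast
  have "\<forall>e\<in>F. card {v \<in> V. v \<in> e} = r"
  proof
    fix e assume "e \<in> F"
    then have "{v \<in> V. v \<in> e} = e" using assms by auto
    then show "card {v \<in> V. v \<in> e} = r" using assms \<open>e \<in> F\<close> unfolding uniform_def by auto
  qed
  from sum_multicount[OF assms(5) fF this] show ?thesis by simp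
qed

text \<open>By linearity the edges through \<open>v\<close> are pairwise disjoint away from
  \<open>v\<close>, so each of them contributes \<open>r - 1\<close> new points.\<close>

lemma card_star:
  assumes "hypergraph H" "uniform r H" "linear_hypergraph H"
  shows "card (star H v) = 1 + card (edges_at H v) * (r - 1)"
proof -
  let ?U = "\<Union>e\<in>edges_at H v. e - {v}"
  have fin: "\<forall>e\<in>edges_at H v. finite (e - {v})"
    using assms hypergraph_finite_edge unfolding edges_at_def by auto
  have "card ?U = (\<Sum>e\<in>edges_at H v. card (e - {v}))"
  proof (rule card_UN_disjoint[OF hypergraph_finite_edges_at[OF assms(1)] fin])
    show "\<forall>e\<in>edges_at H v. \<forall>f\<in>edges_at H v. e \<noteq> f \<longrightarrow> (e - {v}) \<inter> (f - {v}) = {}"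
      using linear_hypergraph_eq[OF assms(1,3)] unfolding edges_at_def by blast
  qed
  also have "\<dots> = (\<Sum>e\<in>edges_at H v. r - 1)"
    using assms unfolding edges_at_def uniform_def by (intro sum.cong) auto
  finally have card: "card ?U = card (edges_at H v) * (r - 1)" by simp
  have star: "star H v = insert v ?U" unfolding star_def edges_at_def by auto
  have "finite ?U" using fin hypergraph_finite_edges_at[OF assms(1)] by blast
  moreover have "v \<notin> ?U" by blast
  ultimately have "card (insert v ?U) = Suc (card ?U)" by (rule card_insert_disjoint)
  then show ?thesis unfolding star card plus_1_eq_Suc .
qed

text \<open>Each edge through \<open>v\<close> that meets \<open>f\<close> does so in a single
  point, and different edges use different points, since two common points \<open>v\<close> and
  \<open>x\<close> would make them equal.\<close>

lemma card_edges_at_meeting: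
  assumes "hypergraph H" "linear_hypergraph H" "f \<in> edges H" "v \<notin> f"
  shows "card {g \<in> edges_at H v. g \<inter> f \<noteq> {}} = card (f \<inter> star H v)"
proof -
  let ?M = "{g \<in> edges_at H v. g \<inter> f \<noteq> {}}"
  have fM: "finite ?M" using hypergraph_finite_edges_at[OF assms(1)] by simp
  have ME: "g \<in> edges H" "v \<in> g" if "g \<in> ?M" for g
    using that unfolding edges_at_def by auto
  have "card (\<Union>g\<in>?M. g \<inter> f) = (\<Sum>g\<in>?M. card (g \<inter> f))"
  proof (rule card_UN_disjoint[OF fM])
    show "\<forall>g\<in>?M. finite (g \<inter> f)" using hypergraph_finite_edge[OF assms(1,3)] by auto
    show "\<forall>g\<in>?M. \<forall>h\<in>?M. g \<noteq> h \<longrightarrow> g \<inter> f \<inter> (h \<inter> f) = {}"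
    proof (intro ballI impI, rule ccontr)
      fix g h assume *: "g \<in> ?M" "h \<in> ?M" "g \<noteq> h" "g \<inter> f \<inter> (h \<inter> f) \<noteq> {}"
      then obtain x where x: "x \<in> g" "x \<in> h" "x \<in> f" by blast
      then have "v \<noteq> x" using assms(4) by blast
      then show False
        using linear_hypergraph_eq[OF assms(1,2) ME(1)[OF *(1)] ME(1)[OF *(2)]
          ME(2)[OF *(1)] ME(2)[OF *(2)] x(1,2)] *(3) by simp
    qed
  qed
  also have "\<dots> = (\<Sum>g\<in>?M. 1)"
  proof (rule sum.cong[OF refl])
    fix g assume g: "g \<in> ?M"
    then have "g \<noteq> f" using ME assms(4) by blast
    then have "card (g \<inter> f) \<le> 1"
      using assms ME(1)[OF g] unfolding linear_hypergraph_def by blast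
    moreover have "card (g \<inter> f) \<noteq> 0"
      using g hypergraph_finite_edge[OF assms(1,3)] by auto
    ultimately show "card (g \<inter> f) = 1" by linarith
  qed
  finally have "card (\<Union>g\<in>?M. g \<inter> f) = card ?M" by simp
  moreover have "(\<Union>g\<in>?M. g \<inter> f) = f \<inter> star H v"
    unfolding star_def using assms(4) by auto
  ultimately show ?thesis by simp
qed

section \<open>The forbidden configuration\<close>

lemma edges_expansion_B4:
  "edges (expansion r B4) = {Inl ` {0, 1} \<union> Inr ` ({{0, 1}} \<times> {..<r - 2}),
     Inl ` {0, 2} \<union> Inr ` ({{0, 2}} \<times> {..<r - 2}),
     Inl ` {0, 3} \<union> Inr ` ({{0, 3}} \<times> {..<r - 2}),
     Inl ` {3, 4} \<union> Inr ` ({{3, 4}} \<times> {..<r - 2})}"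
  unfolding expansion_def B4_def by simp

lemma verts_expansion_B4:
  "verts (expansion r B4) = Inl ` {0, 1, 2, 3, 4}
     \<union> Inr ` ({{0, 1}, {0, 2}, {0, 3}, {3, 4}} \<times> {..<r - 2})"
  unfolding expansion_def B4_def by simp

text \<open>Extracts from a copy of the expansion only the incidences that contradict the parallel
  property of affine planes. Injectivity of the embedding preserves distinctness and
  disjointness.\<close>

lemma contains_B4_imp:
  assumes "contains_hypergraph H (expansion r B4)"
  obtains v e1 e2 e3 f where "e1 \<in> edges_at H v" "e2 \<in> edges_at H v" "e3 \<in> edges_at H v"
    and "e1 \<noteq> e2" "f \<in> edges H" "e3 \<inter> f \<noteq> {}" "e1 \<inter> f = {}" "e2 \<inter> f = {}"
proof -
  let ?ed = "\<lambda>a b :: nat. Inl ` {a, b} \<union> Inr ` ({{a, b}} \<times> {..<r - 2}) :: (nat + nat set \<times> nat) set"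
  let ?V = "verts (expansion r B4)"
  obtain \<phi> where inj: "inj_on \<phi> ?V"
    and im: "\<forall>e\<in>edges (expansion r B4). \<phi> ` e \<in> edges H"
    using assms unfolding contains_hypergraph_def by blast
  have sub: "?ed 0 1 \<subseteq> ?V" "?ed 0 2 \<subseteq> ?V" "?ed 3 4 \<subseteq> ?V"
    unfolding verts_expansion_B4 by auto
  have disj: "{0, 1} \<noteq> {3, 4 :: nat}" "{0, 2} \<noteq> {3, 4 :: nat}"
    by (auto simp: doubleton_eq_iff)
  show thesis
  proof (rule that[of "\<phi> ` ?ed 0 1" "\<phi> (Inl 0)" "\<phi> ` ?ed 0 2" "\<phi> ` ?ed 0 3" "\<phi> ` ?ed 3 4"])
    have "\<forall>e\<in>{?ed 0 1, ?ed 0 2, ?ed 0 3, ?ed 3 4}. \<phi> ` e \<in> edges H"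
      using im unfolding edges_expansion_B4 .
    then have mem: "\<phi> ` ?ed 0 1 \<in> edges H" "\<phi> ` ?ed 0 2 \<in> edges H"
      "\<phi> ` ?ed 0 3 \<in> edges H" "\<phi> ` ?ed 3 4 \<in> edges H"
      by (simp_all only: ball_simps simp_thms)
    have "\<phi> (Inl 0) \<in> \<phi> ` ?ed 0 k" for k by blast
    then show "\<phi> ` ?ed 0 1 \<in> edges_at H (\<phi> (Inl 0))" "\<phi> ` ?ed 0 2 \<in> edges_at H (\<phi> (Inl 0))"
      "\<phi> ` ?ed 0 3 \<in> edges_at H (\<phi> (Inl 0))" "\<phi> ` ?ed 3 4 \<in> edges H"
      using mem unfolding edges_at_def by blast+
    show "\<phi> ` ?ed 0 1 \<noteq> \<phi> ` ?ed 0 2"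
    proof
      assume "\<phi> ` ?ed 0 1 = \<phi> ` ?ed 0 2"
      then have "?ed 0 1 = ?ed 0 2" by (simp only: inj_on_image_eq_iff[OF inj sub(1,2)])
      then have "Inl 1 \<in> ?ed 0 2" by (metis UnI1 image_eqI insertCI)
      then show False by auto
    qed
    have "\<phi> (Inl 3) \<in> \<phi> ` ?ed 0 3" "\<phi> (Inl 3) \<in> \<phi> ` ?ed 3 4" by blast+
    then show "\<phi> ` ?ed 0 3 \<inter> \<phi> ` ?ed 3 4 \<noteq> {}" by blast
    \<comment> \<open>New vertices are tagged by their edge, so expanded edges are disjoint once the
      graph edges are distinct and disjoint.\<close>
    have "(Inl ` s \<union> Inr ` ({s} \<times> A)) \<inter> (Inl ` t \<union> Inr ` ({t} \<times> A)) = {}"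
      if "s \<noteq> t" "s \<inter> t = {}" for s t :: "nat set" and A :: "nat set"
      using that by auto
    note this[OF disj(1)] this[OF disj(2)]
    then have "?ed 0 1 \<inter> ?ed 3 4 = {}" "?ed 0 2 \<inter> ?ed 3 4 = {}" by simp_all
    then show "\<phi> ` ?ed 0 1 \<inter> \<phi> ` ?ed 3 4 = {}" "\<phi> ` ?ed 0 2 \<inter> \<phi> ` ?ed 3 4 = {}"
      by (simp_all only: inj_on_image_Int[OF inj sub(1,3), symmetric]
        inj_on_image_Int[OF inj sub(2,3), symmetric] image_empty)
  qed
qed

text \<open>Splits an edge as the expansion does: two old vertices and \<open>r - 2\<close> new
  ones. Injectivity of \<open>g\<close> is not recorded; a count recovers it for the whole
  embedding.\<close>

lemma obtain_enumeration_pair: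
  assumes "finite e" "card e = r" "x \<in> e" "y \<in> e" "x \<noteq> y"
  obtains g where "e = {x, y} \<union> g ` {..<r - 2}"
proof -
  have "card (e - {x, y}) = r - 2" using assms by (simp add: card_Diff_subset)
  then obtain g where "bij_betw g {0..<r - 2} (e - {x, y})"
    using ex_bij_betw_nat_finite[of "e - {x, y}"] assms(1) by auto
  then have "g ` {..<r - 2} = e - {x, y}" by (simp add: bij_betw_def atLeast0LessThan)
  then have "e = {x, y} \<union> g ` {..<r - 2}" using assms by auto
  then show thesis by (rule that)
qed

lemma obtain_enumeration:
  assumes "finite e" "card e = r" "r \<ge> 2" "x \<in> e"
  obtains y g where "e = {x, y} \<union> g ` {..<r - 2}"
proof -
  have "card (e - {x}) \<noteq> 0" using assms by simp
  then have "e - {x} \<noteq> {}" by (metis card.empty)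
  then obtain y where "y \<in> e" "x \<noteq> y" by blast
  then show thesis using obtain_enumeration_pair[OF assms(1,2,4)] that by metis
qed

text \<open>The embedding only has to map hyperedges onto hyperedges: it is then injective because the
  four hyperedges of the configuration cover as many vertices as the expansion has.\<close>

lemma contains_B4I:
  assumes H: "hypergraph H" "uniform r H" "linear_hypergraph H" and r: "r \<ge> 2"
    and e: "e1 \<in> edges_at H v" "e2 \<in> edges_at H v" "e3 \<in> edges_at H v" "f \<in> edges H"
    and ne: "e1 \<noteq> e2" "v \<notin> f" "e3 \<inter> f \<noteq> {}" "e1 \<inter> f = {}" "e2 \<inter> f = {}"
  shows "contains_hypergraph H (expansion r B4)"
proof -
  have E: "e1 \<in> edges H" "e2 \<in> edges H" "e3 \<in> edges H" and v: "v \<in> e1" "v \<in> e2" "v \<in> e3"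
    using e unfolding edges_at_def by auto
  have fin: "finite e1" "finite e2" "finite e3" "finite f"
    using hypergraph_finite_edge[OF H(1)] E e(4) by auto
  have card: "card e1 = r" "card e2 = r" "card e3 = r" "card f = r"
    using H(2) E e(4) unfolding uniform_def by auto
  obtain u where u: "u \<in> e3" "u \<in> f" using ne(3) by auto
  have uv: "u \<noteq> v" using u ne(2) by auto
  have ne3: "e1 \<noteq> e3" "e2 \<noteq> e3" using ne by auto
  obtain a g1 where 1: "e1 = {v, a} \<union> g1 ` {..<r - 2}"
    using obtain_enumeration[OF fin(1) card(1) r v(1)] by blast
  obtain b g2 where 2: "e2 = {v, b} \<union> g2 ` {..<r - 2}"
    using obtain_enumeration[OF fin(2) card(2) r v(2)] by blast
  obtain g3 where 3: "e3 = {v, u} \<union> g3 ` {..<r - 2}"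
    using obtain_enumeration_pair[OF fin(3) card(3) v(3) u(1)] uv by blast
  obtain c g4 where 4: "f = {u, c} \<union> g4 ` {..<r - 2}"
    using obtain_enumeration[OF fin(4) card(4) r u(2)] by blast
  \<comment> \<open>The centre 0 goes to \<open>v\<close> and the vertex 3 to the common point
    \<open>u\<close> of \<open>e3\<close> and \<open>f\<close>; the leaves 1, 2, 4 go to
    \<open>a\<close>, \<open>b\<close>, \<open>c\<close>. The \<open>i\<close>-th new vertex of each
    edge follows the enumeration of its target.\<close>
  define \<phi> where "\<phi> = case_sum
    (\<lambda>k :: nat. if k = 0 then v else if k = 1 then a else if k = 2 then b
       else if k = 3 then u else c)
    (\<lambda>(s :: nat set, i). if s = {0, 1} then g1 i else if s = {0, 2} then g2 i
       else if s = {0, 3} then g3 i else g4 i)"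
  have \<phi>_Inr: "\<phi> (Inr ({0, 1}, i)) = g1 i" "\<phi> (Inr ({0, 2}, i)) = g2 i"
    "\<phi> (Inr ({0, 3}, i)) = g3 i" "\<phi> (Inr ({3, 4}, i)) = g4 i" for i
    unfolding \<phi>_def by (simp_all add: doubleton_eq_iff)
  have \<phi>_Inl: "\<phi> (Inl 0) = v" "\<phi> (Inl 1) = a" "\<phi> (Inl 2) = b" "\<phi> (Inl 3) = u" "\<phi> (Inl 4) = c"
    unfolding \<phi>_def by simp_all
  have img: "\<phi> ` (Inl ` {k, l} \<union> Inr ` ({s} \<times> A)) = {\<phi> (Inl k), \<phi> (Inl l)} \<union> (\<lambda>i. \<phi> (Inr (s, i))) ` A"
    for k l s A by auto
  have im: "\<phi> ` (Inl ` {0, 1} \<union> Inr ` ({{0, 1}} \<times> {..<r - 2})) = e1"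
    "\<phi> ` (Inl ` {0, 2} \<union> Inr ` ({{0, 2}} \<times> {..<r - 2})) = e2"
    "\<phi> ` (Inl ` {0, 3} \<union> Inr ` ({{0, 3}} \<times> {..<r - 2})) = e3"
    "\<phi> ` (Inl ` {3, 4} \<union> Inr ` ({{3, 4}} \<times> {..<r - 2})) = f"
    unfolding img \<phi>_Inr \<phi>_Inl using 1 2 3 4 by auto
  let ?V = "verts (expansion r B4)"
  have V: "?V = (Inl ` {0, 1} \<union> Inr ` ({{0, 1}} \<times> {..<r - 2})) \<union>
     (Inl ` {0, 2} \<union> Inr ` ({{0, 2}} \<times> {..<r - 2})) \<union>
     (Inl ` {0, 3} \<union> Inr ` ({{0, 3}} \<times> {..<r - 2})) \<union>
     (Inl ` {3, 4} \<union> Inr ` ({{3, 4}} \<times> {..<r - 2}))"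
    unfolding verts_expansion_B4 by auto
  have "\<phi> ` (A \<union> B \<union> C \<union> D) = \<phi> ` A \<union> \<phi> ` B \<union> \<phi> ` C \<union> \<phi> ` D" for A B C D
    by (simp only: image_Un)
  then have imV: "\<phi> ` ?V = e1 \<union> e2 \<union> e3 \<union> f" unfolding V by (simp only: im)
  \<comment> \<open>Removing the repeated points \<open>v\<close> and \<open>u\<close> makes the
    four pieces disjoint, so that their cardinalities add up.\<close>
  have "\<phi> ` ?V = e1 \<union> (e2 - {v}) \<union> (e3 - {v}) \<union> (f - {u})"
    unfolding imV using v u uv by auto
  also have "card \<dots> = r + (r - 1) + (r - 1) + (r - 1)"
  proof -
    note eq = linear_hypergraph_eq[OF H(1,3)]
    have "e1 \<inter> (e2 - {v}) = {}" using eq[OF E(1,2) v(1,2)] ne(1) by blast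
    moreover have "(e1 \<union> (e2 - {v})) \<inter> (e3 - {v}) = {}"
      using eq[OF E(1,3) v(1,3)] eq[OF E(2,3) v(2,3)] ne3 by blast
    moreover have "(e1 \<union> (e2 - {v}) \<union> (e3 - {v})) \<inter> (f - {u}) = {}"
      using eq[OF E(3) e(4) u] ne v by blast
    ultimately show ?thesis using fin card v u by (simp add: card_Un_disjoint)
  qed
  \<comment> \<open>Five old vertices and \<open>r - 2\<close> new ones for each of the four
    edges.\<close>
  finally have "card (\<phi> ` ?V) = 5 + 4 * (r - 2)" using r by simp
  moreover have "card ?V \<le> 5 + 4 * (r - 2)"
  proof -
    let ?A = "Inl ` {0, 1, 2, 3, 4} :: (nat + nat set \<times> nat) set"
    let ?S = "{{0, 1}, {0, 2}, {0, 3}, {3, 4}} :: nat set set"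
    let ?B = "Inr ` (?S \<times> {..<r - 2}) :: (nat + nat set \<times> nat) set"
    have "card ?B \<le> card (?S \<times> {..<r - 2})" by (rule card_image_le) simp
    also have "\<dots> = card ?S * (r - 2)" by (simp add: card_cartesian_product)
    also have "\<dots> \<le> 4 * (r - 2)" by (intro mult_right_mono) (auto simp: card_insert_if)
    finally have "card ?B \<le> 4 * (r - 2)" .
    moreover have "card ?A \<le> 5"
      by (rule order.trans[OF card_image_le]) (auto simp: card_insert_if)
    moreover have "card (?A \<union> ?B) \<le> card ?A + card ?B" by (rule card_Un_le)
    ultimately show ?thesis unfolding verts_expansion_B4 by linarith
  qed
  moreover have "finite ?V" unfolding verts_expansion_B4 by simp
  ultimately have "inj_on \<phi> ?V"
    using card_image_le[of ?V \<phi>] by (intro eq_card_imp_inj_on) auto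
  moreover have "\<phi> ` ?V \<subseteq> verts H"
    unfolding imV using H(1) E e(4) unfolding hypergraph_def by blast
  moreover have "\<forall>e\<in>edges (expansion r B4). \<phi> ` e \<in> edges H"
    unfolding edges_expansion_B4 using im E e(4) by simp
  ultimately show ?thesis unfolding contains_hypergraph_def by blast
qed

section \<open>The upper bound\<close>

text \<open>Some edge through \<open>v\<close> meets \<open>f\<close> and can serve as
  \<open>e3\<close>, so two edges through \<open>v\<close> disjoint from \<open>f\<close> would
  complete a forbidden configuration. All but at most one edge through \<open>v\<close> thus meet
  \<open>f\<close>, and these are counted by the points of \<open>f\<close> in the star.\<close>

lemma degree_le_of_meeting_edge:
  assumes H: "hypergraph H" "uniform r H" "linear_hypergraph H" and r: "r \<ge> 2"
    and free: "hypergraph_free H (expansion r B4)"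
    and f: "f \<in> edges H" "v \<notin> f" "f \<inter> star H v \<noteq> {}"
  shows "card (edges_at H v) \<le> 1 + card (f \<inter> star H v)"
proof -
  let ?D = "{g \<in> edges_at H v. g \<inter> f = {}}" and ?M = "{g \<in> edges_at H v. g \<inter> f \<noteq> {}}"
  have fin: "finite ?D" "finite ?M" using hypergraph_finite_edges_at[OF H(1)] by simp_all
  obtain e where e: "e \<in> edges_at H v" "e \<inter> f \<noteq> {}"
    using f(2,3) unfolding star_def by auto
  have "\<forall>x\<in>?D. \<forall>y\<in>?D. x = y"
  proof (intro ballI, rule ccontr)
    fix x y assume "x \<in> ?D" "y \<in> ?D" "x \<noteq> y"
    then have "contains_hypergraph H (expansion r B4)"
      by (intro contains_B4I[OF H r _ _ e(1) f(1) _ f(2) e(2), of x y]) simp_all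
    then show False using free unfolding hypergraph_free_def by simp
  qed
  then have "card ?D \<le> 1" using card_le_Suc0_iff_eq[OF fin(1)] by simp
  moreover have "?D \<union> ?M = edges_at H v" by auto
  then have "card (edges_at H v) \<le> card ?D + card ?M"
    using card_Un_le[of ?D ?M] by (simp only:)
  ultimately show ?thesis using card_edges_at_meeting[OF H(1,3) f(1,2)] by simp
qed

text \<open>The edges through vertices of degree at least \<open>r + 2\<close> are split off as
  \<open>E1\<close>, and their vertex set is disjoint from that of the remaining edges
  \<open>E2\<close>. On \<open>E2\<close> degrees are at most \<open>r + 1\<close> and double
  counting applies; \<open>E1\<close> is bounded by its private vertices.\<close>

lemma free_degree_sum:
  assumes H: "hypergraph H" "uniform r H" "linear_hypergraph H" and r: "r \<ge> 2"
    and free: "hypergraph_free H (expansion r B4)"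
  shows "r * card (edges H) \<le> (r + 1) * card (verts H)"
    and "r * card (edges H) = (r + 1) * card (verts H) \<Longrightarrow> v \<in> verts H \<Longrightarrow>
      card (edges_at H v) = r + 1"
proof -
  define B where "B = {v \<in> verts H. card (edges_at H v) \<ge> r + 2}"
  define E1 where "E1 = {e \<in> edges H. e \<inter> B \<noteq> {}}"
  define E2 where "E2 = edges H - E1"
  define V2 where "V2 = verts H - \<Union>E1"
  have finE: "finite (edges H)" and finV: "finite (verts H)"
    using H(1) hypergraph_finite_edges unfolding hypergraph_def by auto
  have sub: "e \<subseteq> verts H" if "e \<in> edges H" for e using that H(1) unfolding hypergraph_def by auto
  \<comment> \<open>An edge that reaches the star of \<open>w\<close> but avoids \<open>w\<close>
    would bound the degree of \<open>w\<close> by \<open>r + 1\<close>.\<close>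
  have star_edges: "w \<in> f" if "w \<in> B" "f \<in> edges H" "f \<inter> star H w \<noteq> {}" for w f
  proof (rule ccontr)
    assume "w \<notin> f"
    then have "card (edges_at H w) \<le> 1 + card (f \<inter> star H w)"
      using degree_le_of_meeting_edge[OF H r free] that by blast
    also have "card (f \<inter> star H w) \<le> card f"
      using hypergraph_finite_edge[OF H(1) that(2)] by (intro card_mono) auto
    also have "card f = r" using H(2) that(2) unfolding uniform_def by auto
    finally show False using that(1) unfolding B_def by simp
  qed
  have meet: "w \<in> f" if "w \<in> B" "w \<in> e" "e \<in> edges H" "f \<in> edges H" "e \<inter> f \<noteq> {}" for w e f
    using that by (intro star_edges[OF that(1,4)]) (auto simp: star_def edges_at_def)
  \<comment> \<open>If \<open>e\<close> held a second vertex \<open>x\<close> of \<open>B\<close>,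
    every edge through \<open>w\<close> would meet \<open>e\<close> and so contain \<open>x\<close>
    as well. By linearity it would be \<open>e\<close>, leaving \<open>w\<close> with degree at most
    1.\<close>
  have one: "e \<inter> B = {w}" if "w \<in> B" "w \<in> e" "e \<in> edges H" for w e
  proof -
    have False if x: "x \<in> e" "x \<in> B" "x \<noteq> w" for x
    proof -
      have "edges_at H w \<subseteq> {e}"
      proof
        fix f assume "f \<in> edges_at H w"
        then have f: "f \<in> edges H" "w \<in> f" unfolding edges_at_def by auto
        then have "x \<in> f" using meet[OF x(2,1) \<open>e \<in> edges H\<close> f(1)] \<open>w \<in> e\<close> by blast
        then show "f \<in> {e}"
          using linear_hypergraph_eq[OF H(1,3) f(1) \<open>e \<in> edges H\<close> f(2) \<open>w \<in> e\<close> _ x(1)] x(3) by simp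
      qed
      then have "card (edges_at H w) \<le> 1" using card_mono[of "{e}"] by simp
      then show False using \<open>w \<in> B\<close> unfolding B_def by simp
    qed
    then show ?thesis using that by auto
  qed
  have E1: "card (\<Union>e\<in>E1. e - B) = (\<Sum>e\<in>E1. card (e - B))"
  proof (rule card_UN_disjoint)
    show "finite E1" unfolding E1_def using finE by simp
    show "\<forall>e\<in>E1. finite (e - B)" unfolding E1_def using hypergraph_finite_edge[OF H(1)] by auto
    \<comment> \<open>Two edges of \<open>E1\<close> sharing a point outside \<open>B\<close> also
      share a vertex of \<open>B\<close>, by \<open>meet\<close>, so they coincide.\<close>
    show "\<forall>e\<in>E1. \<forall>f\<in>E1. e \<noteq> f \<longrightarrow> (e - B) \<inter> (f - B) = {}"
    proof (intro ballI impI, rule ccontr)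
      fix e f assume *: "e \<in> E1" "f \<in> E1" "e \<noteq> f" "(e - B) \<inter> (f - B) \<noteq> {}"
      then obtain x w where x: "x \<in> e" "x \<in> f" "x \<notin> B" and w: "w \<in> B" "w \<in> e"
        unfolding E1_def by auto
      have ef: "e \<in> edges H" "f \<in> edges H" using * unfolding E1_def by auto
      have "w \<in> f" using meet[OF w ef] x by blast
      then show False using linear_hypergraph_eq[OF H(1,3) ef] x w \<open>e \<noteq> f\<close> by blast
    qed
  qed
  also have "\<dots> = (\<Sum>e\<in>E1. r - 1)"
  proof (rule sum.cong[OF refl])
    fix e assume "e \<in> E1"
    then obtain w where w: "w \<in> B" "w \<in> e" "e \<in> edges H" unfolding E1_def by auto
    have "e - B = e - {w}" using one[OF w] by blast
    then show "card (e - B) = r - 1" using w H(2) unfolding uniform_def by simp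
  qed
  finally have E1_card: "card (\<Union>e\<in>E1. e - B) = card E1 * (r - 1)" by simp
  have UE1: "\<Union>E1 \<subseteq> verts H" unfolding E1_def using sub by auto
  have cE1: "card E1 * (r - 1) \<le> card (\<Union>E1)"
    unfolding E1_card[symmetric] using finite_subset[OF UE1 finV] by (intro card_mono) auto
  \<comment> \<open>By \<open>meet\<close>, an edge touching a member of \<open>E1\<close> contains
    a vertex of \<open>B\<close> and hence lies in \<open>E1\<close> itself.\<close>
  have UE2: "\<Union>E2 \<subseteq> V2"
  proof
    fix x assume "x \<in> \<Union>E2"
    then obtain f where f: "f \<in> edges H" "f \<notin> E1" "x \<in> f" unfolding E2_def by auto
    have "x \<notin> e" if e: "e \<in> E1" for e
    proof
      assume "x \<in> e"
      obtain w where w: "w \<in> B" "w \<in> e" "e \<in> edges H" using e unfolding E1_def by auto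
      then have "w \<in> f" using meet[OF w f(1)] f(3) \<open>x \<in> e\<close> by blast
      then show False using f w unfolding E1_def by auto
    qed
    then show "x \<in> V2" unfolding V2_def using sub f by auto
  qed
  have deg2: "card {e \<in> E2. x \<in> e} \<le> r + 1" if "x \<in> V2" for x
  proof -
    have "card {e \<in> E2. x \<in> e} \<le> card (edges_at H x)"
      using hypergraph_finite_edges_at[OF H(1)] by (intro card_mono) (auto simp: E2_def edges_at_def)
    moreover have "card {e \<in> E2. x \<in> e} = 0" if "x \<in> B"
    proof -
      have "{e \<in> E2. x \<in> e} = {}" using that unfolding E2_def E1_def by auto
      then show ?thesis by (simp only: card.empty)
    qed
    moreover have "card (edges_at H x) \<le> r + 1" if "x \<notin> B"
      using that \<open>x \<in> V2\<close> unfolding B_def V2_def by auto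
    ultimately show ?thesis by fastforce
  qed
  have finV2: "finite V2" unfolding V2_def using finV by simp
  have sum2: "(\<Sum>x\<in>V2. card {e \<in> E2. x \<in> e}) = r * card E2"
    by (rule sum_degrees[OF H(1,2) _ UE2 finV2]) (auto simp: E2_def)
  have "(\<Sum>x\<in>V2. card {e \<in> E2. x \<in> e}) \<le> (\<Sum>x\<in>V2. r + 1)"
    by (rule sum_mono[OF deg2])
  then have c2: "r * card E2 \<le> (r + 1) * card V2" unfolding sum2 by (simp add: mult.commute)
  have cV: "card (verts H) = card (\<Union>E1) + card V2"
    unfolding V2_def using UE1 finV finite_subset[OF UE1 finV]
    by (simp add: card_Diff_subset card_mono)
  have cE: "card (edges H) = card E1 + card E2"
    unfolding E2_def using finE by (simp add: E1_def card_Diff_subset card_mono)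
  have "r + 1 \<le> (r + 1) * (r - 1)" using r by (cases "r - 1") auto
  then have "card E1 * (r + 1) \<le> card E1 * ((r + 1) * (r - 1))" by (rule mult_left_mono) simp
  also have "\<dots> = (r + 1) * (card E1 * (r - 1))" by (simp only: mult.left_commute)
  also have "\<dots> \<le> (r + 1) * card (\<Union>E1)" using cE1 by (rule mult_left_mono) simp
  \<comment> \<open>The extra summand \<open>card E1\<close> is the slack that forces
    \<open>E1\<close> to be empty when equality holds.\<close>
  finally have c1: "r * card E1 + card E1 \<le> (r + 1) * card (\<Union>E1)"
    by (simp add: algebra_simps)
  show "r * card (edges H) \<le> (r + 1) * card (verts H)"
    unfolding cV cE using c1 c2 by (simp add: algebra_simps)
  assume eq: "r * card (edges H) = (r + 1) * card (verts H)" and v: "v \<in> verts H"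
  have "r * card E1 + r * card E2 = (r + 1) * card (\<Union>E1) + (r + 1) * card V2"
    using eq unfolding cV cE distrib_left .
  then have "card E1 = 0" and eq2: "r * card E2 = (r + 1) * card V2"
    using c1 c2 by linarith+
  then have "E1 = {}" using finE unfolding E1_def by simp
  then have EV: "E2 = edges H" "V2 = verts H" unfolding E2_def V2_def by auto
  have "(\<Sum>x\<in>V2. card {e \<in> E2. x \<in> e}) = (\<Sum>x\<in>V2. r + 1)"
    using eq2 sum2 by (simp add: mult.commute)
  \<comment> \<open>Every term is at most \<open>r + 1\<close> and the sums agree, so each term
    equals \<open>r + 1\<close>.\<close>
  from sum_mono_inv[OF this deg2 _ finV2, of v] show "card (edges_at H v) = r + 1"
    using v unfolding EV edges_at_def by blast
qed

section \<open>Attainment of the linear Turan number\<close>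

text \<open>\<open>Max\<close> is a genuine maximum here: edges are subsets of an
  \<open>n\<close>-element set, which bounds the values, and the edgeless hypergraph is
  \<open>F\<close>-free because \<open>F\<close> has an edge.\<close>

lemma lin_turan_attained:
  assumes "edges F \<noteq> {}"
  obtains H :: "nat hypergraph" where "hypergraph H" "uniform r H" "linear_hypergraph H"
    "card (verts H) = n" "hypergraph_free H F" "lin_turan r n F = card (edges H)"
proof -
  let ?P = "\<lambda>H :: nat hypergraph. hypergraph H \<and> uniform r H \<and> linear_hypergraph H \<and>
    card (verts H) = n \<and> hypergraph_free H F"
  let ?A = "{card (edges H) | H :: nat hypergraph. ?P H}"
  have "?A \<subseteq> {..2 ^ n}"
  proof (clarify, simp)
    fix H :: "nat hypergraph" assume H: "hypergraph H" "n = card (verts H)"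
    then have "card (edges H) \<le> card (Pow (verts H))"
      unfolding hypergraph_def by (intro card_mono) auto
    then show "card (edges H) \<le> 2 ^ card (verts H)"
      using H unfolding hypergraph_def by (simp add: card_Pow)
  qed
  then have fin: "finite ?A" using finite_subset by blast
  have "?P (Hypergraph {..<n} {})"
    using assms unfolding hypergraph_def uniform_def linear_hypergraph_def hypergraph_free_def
      contains_hypergraph_def by auto
  then have "?A \<noteq> {}" by blast
  then have "lin_turan r n F \<in> ?A" unfolding lin_turan_def by (rule Max_in[OF fin])
  then show thesis using that by blast
qed

section \<open>Steiner systems\<close>

lemma steiner_system_linear:
  assumes "steiner_system r m S"
  shows "linear_hypergraph S"
  unfolding linear_hypergraph_def
proof (intro ballI impI, rule ccontr)
  fix e f assume e: "e \<in> edges S" "f \<in> edges S" "e \<noteq> f" "\<not> card (e \<inter> f) \<le> 1"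
  have S: "hypergraph S" using assms unfolding steiner_system_def by auto
  then have "finite (e \<inter> f)" using hypergraph_finite_edge e(1) by auto
  then obtain x y where "x \<in> e \<inter> f" "y \<in> e \<inter> f" "x \<noteq> y"
    using e(4) card_le_Suc0_iff_eq by (metis One_nat_def)
  moreover have "e \<subseteq> verts S" using S e unfolding hypergraph_def by auto
  ultimately show False using e assms unfolding steiner_system_def by blast
qed

lemma steiner_system_star:
  assumes "steiner_system r m S" "v \<in> verts S"
  shows "star S v = verts S"
proof
  show "star S v \<subseteq> verts S"
    using assms by (simp add: star_subset_verts steiner_system_def)
  show "verts S \<subseteq> star S v"
  proof
    fix y assume "y \<in> verts S"
    then have "v \<noteq> y \<longrightarrow> (\<exists>b\<in>edges S. v \<in> b \<and> y \<in> b)"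
      using assms unfolding steiner_system_def by blast
    then show "y \<in> star S v" unfolding star_def edges_at_def by auto
  qed
qed

text \<open>The star of any point is the whole system, so the degree \<open>d\<close> solves
  \<open>r\<^sup>2 = 1 + d * (r - 1)\<close>.\<close>

lemma steiner_system_degree:
  assumes "steiner_system r (r\<^sup>2) S" "v \<in> verts S" "r \<ge> 2"
  shows "card (edges_at S v) = r + 1"
proof -
  have "hypergraph S" "uniform r S" "card (verts S) = r\<^sup>2"
    using assms unfolding steiner_system_def by auto
  then have "r\<^sup>2 = 1 + card (edges_at S v) * (r - 1)"
    using card_star[of S r v] steiner_system_linear[OF assms(1)]
      steiner_system_star[OF assms(1,2)] by simp
  moreover have "r\<^sup>2 = 1 + (r + 1) * (r - 1)"
    using assms(3) by (cases r) (auto simp: power2_eq_square)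
  ultimately have "card (edges_at S v) * (r - 1) = (r + 1) * (r - 1)" by linarith
  then show ?thesis using assms(3) unfolding mult_cancel2 by simp
qed

text \<open>Uniqueness of parallels in an affine plane of order \<open>r\<close>: of the
  \<open>r + 1\<close> lines through \<open>v\<close>, exactly \<open>r\<close> meet
  \<open>f\<close>, one for each point of \<open>f\<close>, so only one can miss it.\<close>

lemma steiner_system_parallel:
  assumes S: "steiner_system r (r\<^sup>2) S" and r: "r \<ge> 2"
    and e: "e1 \<in> edges_at S v" "e2 \<in> edges_at S v" "f \<in> edges S"
    and disj: "e1 \<inter> f = {}" "e2 \<inter> f = {}"
  shows "e1 = e2"
proof (rule ccontr)
  assume ne: "e1 \<noteq> e2"
  have H: "hypergraph S" "uniform r S" using S unfolding steiner_system_def by auto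
  have v: "v \<in> verts S" "v \<notin> f" using e H(1) disj unfolding edges_at_def hypergraph_def by auto
  have "f \<inter> star S v = f"
    using steiner_system_star[OF S v(1)] H(1) e(3) unfolding hypergraph_def by auto
  then have "card {g \<in> edges_at S v. g \<inter> f \<noteq> {}} = r"
    using card_edges_at_meeting[OF H(1) steiner_system_linear[OF S] e(3) v(2)] H(2) e(3)
    unfolding uniform_def by simp
  moreover have "card ({e1, e2} \<union> {g \<in> edges_at S v. g \<inter> f \<noteq> {}}) =
      card {e1, e2} + card {g \<in> edges_at S v. g \<inter> f \<noteq> {}}"
    using disj hypergraph_finite_edges_at[OF H(1)] by (intro card_Un_disjoint) auto
  moreover have "card ({e1, e2} \<union> {g \<in> edges_at S v. g \<inter> f \<noteq> {}}) \<le> card (edges_at S v)"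
    using e hypergraph_finite_edges_at[OF H(1)] by (intro card_mono) auto
  ultimately show False using ne steiner_system_degree[OF S v(1) r] by simp
qed

section \<open>Disjoint unions of Steiner systems\<close>

lemma edges_at_disjoint_union:
  assumes C: "\<forall>S\<in>\<C>. hypergraph S" "pairwise (\<lambda>S T. disjnt (verts S) (verts T)) \<C>"
    and E: "edges H = (\<Union>S\<in>\<C>. edges S)" and S: "S \<in> \<C>" "v \<in> verts S"
  shows "edges_at H v = edges_at S v"
proof -
  have "T = S" if "T \<in> \<C>" "e \<in> edges T" "v \<in> e" for e T
    using that C S unfolding pairwise_def disjnt_def hypergraph_def by blast
  then show ?thesis using S E unfolding edges_at_def by blast
qed

text \<open>Degrees are computed within a single piece and all equal \<open>r + 1\<close>, which
  gives the edge count. A forbidden configuration would also lie in one piece and violate uniqueness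
  of parallels.\<close>

lemma disjoint_union_steiner_imp:
  assumes H: "hypergraph H" "uniform r H" and r: "r \<ge> 2"
    and D: "disjoint_union_of (steiner_system r (r\<^sup>2)) H"
  shows "hypergraph_free H (expansion r B4)"
    and "r * card (edges H) = (r + 1) * card (verts H)"
proof -
  obtain \<C> where C: "\<forall>S\<in>\<C>. steiner_system r (r\<^sup>2) S"
    "pairwise (\<lambda>S T. disjnt (verts S) (verts T)) \<C>"
    and V: "verts H = (\<Union>S\<in>\<C>. verts S)" and E: "edges H = (\<Union>S\<in>\<C>. edges S)"
    using D unfolding disjoint_union_of_def by blast
  have CH: "\<forall>S\<in>\<C>. hypergraph S" using C(1) unfolding steiner_system_def by blast
  note at = edges_at_disjoint_union[OF CH C(2) E]
  have "card (edges_at H v) = r + 1" if v: "v \<in> verts H" for v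
  proof -
    obtain S where "S \<in> \<C>" "v \<in> verts S" using v V by blast
    then show ?thesis using at[of S v] steiner_system_degree[of r S v] r C(1) by simp
  qed
  then have "(\<Sum>v\<in>verts H. card (edges_at H v)) = card (verts H) * (r + 1)" by simp
  moreover have "(\<Sum>v\<in>verts H. card (edges_at H v)) = r * card (edges H)"
    unfolding edges_at_def using H(1)
    by (intro sum_degrees[OF H]) (auto simp: hypergraph_def)
  ultimately show "r * card (edges H) = (r + 1) * card (verts H)" by (simp add: mult.commute)
  show "hypergraph_free H (expansion r B4)"
    unfolding hypergraph_free_def
  proof
    assume "contains_hypergraph H (expansion r B4)"
    then obtain v e1 e2 e3 f where e: "e1 \<in> edges_at H v" "e2 \<in> edges_at H v" "e3 \<in> edges_at H v"
      and f: "e1 \<noteq> e2" "f \<in> edges H" "e3 \<inter> f \<noteq> {}" "e1 \<inter> f = {}" "e2 \<inter> f = {}"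
      by (rule contains_B4_imp)
    have "v \<in> verts H" using e(1) H(1) unfolding edges_at_def hypergraph_def by blast
    then obtain S where S: "S \<in> \<C>" "v \<in> verts S" using V by blast
    obtain u where u: "u \<in> e3" "u \<in> f" using f(3) by blast
    \<comment> \<open>The edge \<open>e3\<close> lies in the piece of \<open>v\<close>, and its
      point \<open>u\<close> carries \<open>f\<close> into the same piece.\<close>
    have e3: "e3 \<in> edges_at S v" using at[OF S] e(3) by simp
    then have "u \<in> verts S" using u CH S unfolding edges_at_def hypergraph_def by blast
    then have "edges_at H u = edges_at S u" by (rule at[OF S(1)])
    then have "f \<in> edges S" using f(2) u unfolding edges_at_def by blast
    then show False
      using steiner_system_parallel[OF _ r, of S e1 v e2 f] C(1) S(1) e at[OF S] f by simp
  qed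
qed

section \<open>The structure of extremal hypergraphs\<close>

lemma regular_free_imp_disjoint_union:
  assumes H: "hypergraph H" "uniform r H" "linear_hypergraph H" and r: "r \<ge> 2"
    and free: "hypergraph_free H (expansion r B4)"
    and deg: "\<And>v. v \<in> verts H \<Longrightarrow> card (edges_at H v) = r + 1"
  shows "disjoint_union_of (steiner_system r (r\<^sup>2)) H"
proof -
  have finV: "finite (verts H)" and sub: "\<And>e. e \<in> edges H \<Longrightarrow> e \<subseteq> verts H"
    using H(1) unfolding hypergraph_def by auto
  have card_st: "card (star H v) = r\<^sup>2" if "v \<in> verts H" for v
  proof -
    have "r\<^sup>2 = 1 + (r + 1) * (r - 1)"
      using r by (cases r) (auto simp: power2_eq_square)
    then show ?thesis using card_star[OF H] deg[OF that] by simp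
  qed
  have fin_st: "finite (star H v)" if "v \<in> verts H" for v
    using star_subset_verts[OF H(1) that] finV finite_subset by blast
  \<comment> \<open>With degree exactly \<open>r + 1\<close> the degree inequality says that all
    \<open>r\<close> points of \<open>f\<close> lie in the star.\<close>
  have closed: "f \<subseteq> star H v" if v: "v \<in> verts H" and f: "f \<in> edges H" "f \<inter> star H v \<noteq> {}" for v f
  proof (cases "v \<in> f")
    case True
    then show ?thesis using f unfolding star_def edges_at_def by auto
  next
    case False
    have "r \<le> card (f \<inter> star H v)"
      using degree_le_of_meeting_edge[OF H r free f(1) False f(2)] deg[OF v] by simp
    then have "f \<inter> star H v = f"
      using H(2) f(1) hypergraph_finite_edge[OF H(1) f(1)] unfolding uniform_def
      by (intro card_subset_eq) (auto intro!: antisym card_mono)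
    then show ?thesis by blast
  qed
  \<comment> \<open>Closedness gives one inclusion and the common size \<open>r\<^sup>2\<close>
    turns it into equality; hence stars are equal or disjoint.\<close>
  have star_eq: "star H u = star H v" if v: "v \<in> verts H" and u: "u \<in> star H v" for u v
  proof (rule card_subset_eq[OF fin_st[OF v]])
    have uV: "u \<in> verts H" using u star_subset_verts[OF H(1) v] by blast
    show "star H u \<subseteq> star H v"
      using closed[OF v] u unfolding star_def[of H u] edges_at_def by blast
    show "card (star H u) = card (star H v)" using card_st uV v by simp
  qed
  \<comment> \<open>Vertices with the same star yield the same \<open>comp\<close>, so taking the
    image over all vertices lists each piece once.\<close>
  define comp where "comp v = Hypergraph (star H v) {e \<in> edges H. e \<subseteq> star H v}" for v
  have steiner: "steiner_system r (r\<^sup>2) (comp v)" if v: "v \<in> verts H" for v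
    unfolding steiner_system_def
  proof (intro conjI ballI impI)
    show "hypergraph (comp v)" unfolding hypergraph_def comp_def using fin_st[OF v] by simp
    show "card (verts (comp v)) = r\<^sup>2" unfolding comp_def using card_st[OF v] by simp
    show "uniform r (comp v)" using H(2) unfolding uniform_def comp_def by simp
    fix x y assume xy: "x \<in> verts (comp v)" "y \<in> verts (comp v)" "x \<noteq> y"
    then have x: "x \<in> star H v" and "y \<in> star H v" unfolding comp_def by auto
    then have "y \<in> star H x" using star_eq[OF v x] by simp
    then obtain b where b: "b \<in> edges H" "x \<in> b" "y \<in> b"
      using xy(3) unfolding star_def edges_at_def by auto
    have "b \<subseteq> star H v" using closed[OF v b(1)] b(2) x by blast
    then have bc: "b \<in> edges (comp v)" using b(1) unfolding comp_def by simp
    show "\<exists>!b. b \<in> edges (comp v) \<and> x \<in> b \<and> y \<in> b"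
    proof (rule ex1I)
      show "b \<in> edges (comp v) \<and> x \<in> b \<and> y \<in> b" using bc b(2,3) by simp
    next
      fix c assume "c \<in> edges (comp v) \<and> x \<in> c \<and> y \<in> c"
      then have c: "c \<in> edges H" "x \<in> c" "y \<in> c" unfolding comp_def by simp_all
      show "c = b"
        by (rule linear_hypergraph_eq[OF H(1,3) c(1) b(1) c(2) b(2) c(3) b(3) xy(3)])
    qed
  qed
  have "pairwise (\<lambda>S T. disjnt (verts S) (verts T)) (comp ` verts H)"
  proof (rule pairwiseI)
    fix S T assume "S \<in> comp ` verts H" "T \<in> comp ` verts H" "S \<noteq> T"
    then obtain v w where vw: "v \<in> verts H" "w \<in> verts H" "S = comp v" "T = comp w" by blast
    have "star H v \<noteq> star H w" using \<open>S \<noteq> T\<close> vw unfolding comp_def by auto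
    then have "star H v \<inter> star H w = {}" using star_eq vw(1,2) by blast
    then show "disjnt (verts S) (verts T)" unfolding disjnt_def vw comp_def by simp
  qed
  moreover have "verts H = (\<Union>S\<in>comp ` verts H. verts S)"
    unfolding comp_def using star_subset_verts[OF H(1)] by (auto simp: star_def)
  moreover have "edges H = (\<Union>S\<in>comp ` verts H. edges S)"
  proof
    show "edges H \<subseteq> (\<Union>S\<in>comp ` verts H. edges S)"
    proof
      fix e assume e: "e \<in> edges H"
      \<comment> \<open>An empty edge would lie in no star through a point of its own; uniformity
        with \<open>r \<ge> 2\<close> excludes it.\<close>
      then have "e \<noteq> {}" using H(2) r unfolding uniform_def by auto
      then obtain v where "v \<in> e" by blast
      then have "v \<in> verts H" "e \<subseteq> star H v"
        using e sub by (auto simp: star_def edges_at_def)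
      then show "e \<in> (\<Union>S\<in>comp ` verts H. edges S)" using e unfolding comp_def by auto
    qed
  qed (auto simp: comp_def)
  moreover have "\<forall>S\<in>comp ` verts H. steiner_system r (r\<^sup>2) S" using steiner by blast
  ultimately show ?thesis unfolding disjoint_union_of_def by blast
qed

theorem theorem3:
  fixes r n :: nat
  assumes "r \<ge> 3" and "n \<ge> 1"
  shows "real (lin_turan r n (expansion r B4)) \<le> (real r + 1) * real n / real r \<and>
    ((\<exists>S :: nat hypergraph. steiner_system r (r\<^sup>2) S) \<longrightarrow>
      (\<forall>H :: 'a hypergraph.
        hypergraph H \<and> uniform r H \<and> linear_hypergraph H \<and> card (verts H) = n \<longrightarrow>
        (hypergraph_free H (expansion r B4) \<and>
           real (card (edges H)) = (real r + 1) * real n / real r \<longleftrightarrow>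
         disjoint_union_of (steiner_system r (r\<^sup>2)) H)))"
proof (intro conjI impI allI)
  have r: "r \<ge> 2" "real r > 0" using assms(1) by auto
  have "edges (expansion r B4) \<noteq> {}" unfolding edges_expansion_B4 by simp
  from lin_turan_attained[OF this, of r n]
  obtain H :: "nat hypergraph" where H: "hypergraph H" "uniform r H" "linear_hypergraph H"
    "card (verts H) = n" "hypergraph_free H (expansion r B4)"
    and t: "lin_turan r n (expansion r B4) = card (edges H)" by blast
  have "r * card (edges H) \<le> (r + 1) * n"
    using free_degree_sum(1)[OF H(1-3) r(1) H(5)] H(4) by simp
  then have "real (r * card (edges H)) \<le> real ((r + 1) * n)" by (rule of_nat_mono)
  then show "real (lin_turan r n (expansion r B4)) \<le> (real r + 1) * real n / real r"
    unfolding t using r(2) by (simp add: field_simps)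
next
  fix H :: "'a hypergraph"
  assume "hypergraph H \<and> uniform r H \<and> linear_hypergraph H \<and> card (verts H) = n"
  then have H: "hypergraph H" "uniform r H" "linear_hypergraph H" "card (verts H) = n" by auto
  have r: "r \<ge> 2" "real r > 0" using assms(1) by auto
  \<comment> \<open>Clearing the denominator turns the real equation into the natural-number
    equation treated by the counting lemmas.\<close>
  have "real (card (edges H)) = (real r + 1) * real n / real r \<longleftrightarrow>
      real (r * card (edges H)) = real ((r + 1) * n)"
    using r(2) by (simp add: field_simps)
  then have eq: "real (card (edges H)) = (real r + 1) * real n / real r \<longleftrightarrow>
      r * card (edges H) = (r + 1) * card (verts H)"
    unfolding H(4) of_nat_eq_iff .
  show "hypergraph_free H (expansion r B4) \<and>
      real (card (edges H)) = (real r + 1) * real n / real r \<longleftrightarrow>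
    disjoint_union_of (steiner_system r (r\<^sup>2)) H"
    unfolding eq
    using regular_free_imp_disjoint_union[OF H(1-3) r(1)] free_degree_sum(2)[OF H(1-3) r(1)]
      disjoint_union_steiner_imp[OF H(1,2) r(1)] by blast
qed

end
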